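(* Let $n \geq 1$ and let $s$ be a fixed integer with $1 \leq s \leq n$ (the cardinality of a fixed non-empty subset of $[n]$). Then $$\mathbb{S}^n_+ = \mathrm{cone}\Big( \bigcup_{F \in V_s(\mathbb{R}^n)} F[\mathbb{S}^s_+]F^T \Big),$$ where, for $F \in V_s(\mathbb{R}^n)$, $$F[\mathbb{S}^s_+]F^T := \{ X \in \mathbb{S}^n_+ : X = F Y F^T \text{ for some } Y \in \mathbb{S}^s_+ \},$$ and each set $F[\mathbb{S}^s_+]F^T$ is itself a sub-cone (of $\mathbb{S}^n_+$).
   Context: $[n] = \{1,\dots,n\}$. $\mathbb{S}^n$ is the set of real symmetric $n\times n$ matrices, and $\mathbb{S}^n_+$ is the set of $A \in \mathbb{S}^n$ with $x^T A x \geq 0$ for all $x \in \mathbb{R}^n$ (similarly $\mathbb{S}^s_+$). $V_s(\mathbb{R}^n) := \{A \in \mathbb{R}^{n\times s} : A^T A = I_s\}$ is the Stiefel manifold, i.e. the set of $n\times s$ matrices with orthonormal columns. For a set $C$ in a real vector space, $\mathrm{cone}(C) := \{\sum_{i=1}^k \alpha_i x_i : x_i \in C,\ \alpha_i \in \mathbb{R}_{\geq 0},\ k \in \mathbb{N}\}$. *)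

theory Defs
  imports "HOL-Analysis.Analysis"
begin

definition sym_mats :: "(real^'n^'n) set" where
  "sym_mats = {A. transpose A = A}"

definition psd_mats :: "(real^'n^'n) set" where
  "psd_mats = {A \<in> sym_mats. \<forall>x. x \<bullet> (A *v x) \<ge> 0}"

(* real^'s^'n is the type of matrices with CARD('n) rows and CARD('s) columns. *)
definition stiefel :: "(real^'s^'n) set" where
  "stiefel = {A. transpose A ** A = mat 1}"

(* The library predicate Convex.cone says that a set is closed under non-negative scaling;
   here we need the set of all finite non-negative linear combinations. The case k = 0
   contributes 0, which only matters when C is empty. *)
definition cone_of :: "'a::real_vector set \<Rightarrow> 'a set" where
  "cone_of C = {(\<Sum>i<k. \<alpha> i *\<^sub>R x i) | (k::nat) \<alpha> x. \<forall>i<k. x i \<in> C \<and> \<alpha> i \<ge> 0}"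

definition psd_block :: "real^'s^'n \<Rightarrow> (real^'n^'n) set" where
  "psd_block F = {X \<in> psd_mats. \<exists>Y \<in> (psd_mats :: (real^'s^'s) set). X = F ** Y ** transpose F}"

end

theory Submission
  imports Defs
begin

text \<open>
  Symmetric elimination: if $A$ is positive semidefinite with $A_{ii} > 0$, then
  $A - A_{ii}^{-1} (A e_i)(A e_i)^T$ is again positive semidefinite, its $i$-th diagonal entry
  vanishes, and every vanishing diagonal entry stays zero. As a positive semidefinite matrix
  with zero diagonal is zero, $A$ is a finite sum of matrices $v v^T$.
  If $Q$ is orthogonal with $\|v\|\, Q e_k = v$ and $F$ consists of $s$ columns of $Q$
  including the $k$-th, then $F$ has orthonormal columns and $v = F y$ for a multiple $y$ of a
  unit vector, so that $v v^T = F (y y^T) F^T$.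
\<close>

section \<open>Rank-one matrices\<close>

definition outer :: "real^'n \<Rightarrow> real^'m \<Rightarrow> real^'m^'n" where
  "outer v w = (\<chi> i j. v $ i * w $ j)"

lemma outer_nth [simp]: "outer v w $ i $ j = v $ i * w $ j"
  by (simp add: outer_def)

lemma transpose_outer [simp]: "transpose (outer v w) = outer w v"
  by (simp add: outer_def transpose_def vec_eq_iff)

lemma outer_mult_vector: "outer v w *v x = (w \<bullet> x) *\<^sub>R v"
  by (simp add: vec_eq_iff matrix_vector_mult_def inner_vec_def sum_distrib_left mult_ac)

lemma matrix_mult_outer: "F ** outer x w = outer (F *v x) w"
  by (simp add: vec_eq_iff matrix_matrix_mult_def matrix_vector_mult_def sum_distrib_right mult.assoc)

lemma outer_matrix_vector:
  "outer (F *v x) (G *v y) = F ** outer x y ** transpose G"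
proof -
  have "outer x y ** transpose G = transpose (G ** outer y x)"
    by (simp add: matrix_transpose_mul)
  also have "\<dots> = outer x (G *v y)"
    by (simp add: matrix_mult_outer)
  finally show ?thesis
    by (metis matrix_mul_assoc matrix_mult_outer)
qed

section \<open>The positive semidefinite cone and its congruence images\<close>

lemma psd_mats_iff:
  "A \<in> psd_mats \<longleftrightarrow> transpose A = A \<and> (\<forall>x. 0 \<le> x \<bullet> (A *v x))"
  by (simp add: psd_mats_def sym_mats_def)

lemma psd_nonneg: "A \<in> psd_mats \<Longrightarrow> 0 \<le> x \<bullet> (A *v x)"
  by (simp add: psd_mats_iff)

lemma psd_nth_commute:
  assumes "A \<in> psd_mats"
  shows "A $ i $ j = A $ j $ i"
proof -
  have "transpose A $ j $ i = A $ j $ i"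
    using assms by (simp add: psd_mats_iff)
  then show ?thesis
    by (simp add: transpose_def)
qed

lemma transpose_add: "transpose (A + B) = transpose A + transpose B"
  by (simp add: transpose_def vec_eq_iff)

lemma convex_cone_psd_mats: "convex_cone (psd_mats :: (real^'n^'n) set)"
  by (auto simp: convex_cone_iff psd_mats_iff transpose_add transpose_scalar
      matrix_vector_mult_add_rdistrib inner_add_right
      simp flip: scaleR_matrix_vector_assoc)
    (simp add: transpose_def vec_eq_iff)

lemma outer_self_psd: "outer v v \<in> psd_mats"
  by (simp add: psd_mats_iff outer_mult_vector inner_commute)

text \<open>Moving \<open>F\<close> across the inner product turns the quadratic form at
  \<open>x\<close> into that of \<open>Y\<close> at \<open>transpose F *v x\<close>.\<close>

lemma congruence_psd:
  assumes "Y \<in> psd_mats"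
  shows "F ** Y ** transpose F \<in> psd_mats"
proof -
  have "x \<bullet> ((F ** Y ** transpose F) *v x) = (transpose F *v x) \<bullet> (Y *v (transpose F *v x))" for x
    by (simp only: matrix_vector_mul_assoc[symmetric] dot_lmul_matrix[symmetric]
        transpose_matrix_vector)
  then show ?thesis
    using assms by (simp add: psd_mats_iff matrix_transpose_mul matrix_mul_assoc)
qed

lemma psd_block_eq_image:
  "psd_block F = (\<lambda>Y. F ** Y ** transpose F) ` psd_mats"
  by (auto simp: psd_block_def congruence_psd)

lemma matrix_add_rdistrib: "(A + B) ** C = A ** C + B ** C"
  by (simp add: matrix_matrix_mult_def vec_eq_iff sum.distrib distrib_right)

text \<open>A linear image of a convex cone is a convex cone, and congruence by \<open>F\<close> is
  linear in \<open>Y\<close>.\<close>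

lemma convex_cone_psd_block: "convex_cone (psd_block F)"
proof -
  have "linear (\<lambda>Y. F ** Y ** transpose F)"
    by (auto intro!: linearI simp: matrix_add_ldistrib matrix_add_rdistrib matrix_scalar_ac
        simp flip: scalar_matrix_assoc)
  then show ?thesis
    unfolding psd_block_eq_image
    using convex_cone_linear_image convex_cone_psd_mats by blast
qed

section \<open>Elimination of diagonal entries\<close>

lemma psd_diagonal_nonneg:
  assumes "A \<in> psd_mats"
  shows "0 \<le> A $ i $ i"
  using psd_nonneg[OF assms, of "axis i 1"]
  by (simp add: matrix_vector_mult_basis inner_axis' column_def)

lemma psd_zero_diagonal:
  assumes A: "A \<in> psd_mats" and diag: "\<And>i. A $ i $ i = 0"
  shows "A = 0"
proof -
  have "A $ i $ j = 0" for i j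
  proof -
    \<comment> \<open>On \<open>e_i + t e_j\<close> the diagonal terms vanish and only the mixed
      terms survive. The form is then linear in \<open>t\<close>, so nonnegativity at 1 and -1
      forces the coefficient to be 0.\<close>
    have "0 \<le> 2 * t * A $ i $ j" for t
      using psd_nonneg[OF A, of "axis i 1 + t *\<^sub>R axis j 1"] psd_nth_commute[OF A, of i j]
      by (simp add: matrix_vector_right_distrib matrix_vector_mult_scaleR
          matrix_vector_mult_basis inner_add_left inner_axis' column_def diag)
    from this[of 1] this[of "-1"] show ?thesis
      by simp
  qed
  then show ?thesis
    by (simp add: vec_eq_iff)
qed

text \<open>Completing the square: the new form at \<open>x\<close> is the old form at a suitable
  point \<open>x - t e_i\<close>, hence nonnegative.\<close>

lemma psd_eliminate:
  assumes A: "A \<in> psd_mats" and pos: "0 < A $ i $ i"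
  shows "A - (1 / A $ i $ i) *\<^sub>R outer (column i A) (column i A) \<in> psd_mats"
proof -
  define a where "a = A $ i $ i"
  define c where "c = column i A"
  have a: "a > 0"
    using pos by (simp add: a_def)
  have quad: "0 \<le> x \<bullet> (A *v x) - (1 / a) * (c \<bullet> x)\<^sup>2" for x
  proof -
    \<comment> \<open>This \<open>t\<close> minimizes the form of \<open>A\<close> on the line of
      points \<open>x - t e_i\<close>, a quadratic in \<open>t\<close> with leading coefficient
      \<open>a > 0\<close>.\<close>
    define t where "t = (c \<bullet> x) / a"
    have Ae: "A *v axis i 1 = c"
      by (simp add: c_def matrix_vector_mult_basis)
    \<comment> \<open>Symmetry of \<open>A\<close> lets it move to the other side of the inner
      product.\<close>
    have "axis i 1 \<bullet> (A *v x) = c \<bullet> x"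
      using A Ae by (metis dot_lmul_matrix psd_mats_iff vector_transpose_matrix)
    moreover have "axis i 1 \<bullet> c = a"
      by (simp add: inner_axis' c_def column_def a_def)
    ultimately have "(x - t *\<^sub>R axis i 1) \<bullet> (A *v (x - t *\<^sub>R axis i 1))
        = x \<bullet> (A *v x) - 2 * t * (c \<bullet> x) + t\<^sup>2 * a"
      by (simp add: matrix_vector_mult_diff_distrib matrix_vector_mult_scaleR Ae
          inner_diff_left inner_diff_right inner_commute[of x c] power2_eq_square algebra_simps)
    also have "\<dots> = x \<bullet> (A *v x) - (1 / a) * (c \<bullet> x)\<^sup>2"
      using a by (simp add: t_def power2_eq_square field_simps)
    finally show ?thesis
      using psd_nonneg[OF A] by metis
  qed
  have "transpose (A - (1 / a) *\<^sub>R outer c c) = A - (1 / a) *\<^sub>R outer c c"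
    using psd_nth_commute[OF A] by (simp add: transpose_def vec_eq_iff)
  moreover have "0 \<le> x \<bullet> ((A - (1 / a) *\<^sub>R outer c c) *v x)" for x
    using quad[of x]
    by (simp add: matrix_vector_mult_diff_rdistrib outer_mult_vector inner_diff_right
        power2_eq_square inner_commute[of x c] flip: scaleR_matrix_vector_assoc)
  ultimately show ?thesis
    by (simp add: psd_mats_iff a_def c_def)
qed

text \<open>The decomposition into matrices \<open>outer v v\<close>, stated as an induction rule.
  The measure is the number of nonzero diagonal entries, which each elimination lowers.\<close>

lemma psd_induct [consumes 1, case_names zero add_outer]:
  assumes "A \<in> psd_mats"
    and zero: "P 0"
    and add_outer: "\<And>B v. B \<in> psd_mats \<Longrightarrow> P B \<Longrightarrow> P (B + outer v v)"
  shows "P A"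
  using assms(1)
proof (induction "card {i. A $ i $ i \<noteq> 0}" arbitrary: A rule: less_induct)
  case less
  show ?case
  proof (cases "\<forall>i. A $ i $ i = 0")
    case True
    then show ?thesis
      using psd_zero_diagonal[OF less.prems] zero by simp
  next
    case False
    then obtain i where "A $ i $ i \<noteq> 0"
      by blast
    then have pos: "0 < A $ i $ i"
      using psd_diagonal_nonneg[OF less.prems, of i] by simp
    define c where "c = column i A"
    define B where "B = A - (1 / A $ i $ i) *\<^sub>R outer c c"
    have B: "B \<in> psd_mats"
      using psd_eliminate[OF less.prems pos] by (simp add: B_def c_def)
    have "B $ i $ i = 0"
      using pos by (simp add: B_def c_def column_def)
    moreover have "B $ j $ j = 0" if "A $ j $ j = 0" for j
    proof -
      \<comment> \<open>With \<open>A_jj = 0\<close> the entry is \<open>- c_j^2 / A_ii\<close>;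
        semidefiniteness of \<open>B\<close> supplies the opposite inequality.\<close>
      have "B $ j $ j \<le> 0"
        using that pos by (simp add: B_def)
      then show ?thesis
        using psd_diagonal_nonneg[OF B, of j] by simp
    qed
    ultimately have "{j. B $ j $ j \<noteq> 0} \<subset> {j. A $ j $ j \<noteq> 0}"
      using \<open>A $ i $ i \<noteq> 0\<close> by blast
    then have "card {j. B $ j $ j \<noteq> 0} < card {j. A $ j $ j \<noteq> 0}"
      by (intro psubset_card_mono) simp_all
    then have "P B"
      using B by (rule less.hyps)
    \<comment> \<open>The square root absorbs the factor \<open>1 / A_ii\<close> into both copies of
      the vector.\<close>
    moreover define v where "v = (1 / sqrt (A $ i $ i)) *\<^sub>R c"
    have "A = B + outer v v"
      using pos by (simp add: B_def v_def vec_eq_iff)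
    ultimately show ?thesis
      using add_outer[OF B, of v] by metis
  qed
qed

section \<open>Matrices with orthonormal columns\<close>

lemma stiefel_range_contains:
  fixes v :: "real^'n"
  assumes "CARD('s::finite) \<le> CARD('n::finite)"
  obtains F :: "real^'s^'n" and y where "F \<in> stiefel" "F *v y = v"
proof -
  obtain g :: "'s \<Rightarrow> 'n" where g: "inj g"
    using card_le_inj[of "UNIV :: 's set" "UNIV :: 'n set"] assms by auto
  \<comment> \<open>Any column index serves; types are inhabited, which encodes
    \<open>s >= 1\<close>.\<close>
  fix j0 :: 's
  obtain u :: "real^'n" where u: "norm u = 1" "norm v *\<^sub>R u = v"
  proof (cases "v = 0")
    case True
    then show ?thesis
      \<comment> \<open>For \<open>v = 0\<close> the factor \<open>norm v\<close> is 0, so an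
        arbitrary unit vector will do.\<close>
      using that[of "axis undefined 1"] by simp
  next
    case False
    then show ?thesis
      using that[of "v /\<^sub>R norm v"] by simp
  qed
  obtain Q :: "real^'n^'n" where Q: "orthogonal_matrix Q" "Q *v axis (g j0) 1 = u"
    using orthogonal_matrix_exists_basis u(1) by metis
  \<comment> \<open>The columns of \<open>Q\<close> selected by \<open>g\<close>; injectivity makes
    them distinct, hence orthonormal, and column \<open>j0\<close> is \<open>u\<close>.\<close>
  define F :: "real^'s^'n" where "F = (\<chi> i j. Q $ i $ g j)"
  have col: "column j F = column (g j) Q" for j
    by (simp add: F_def column_def)
  have "column i Q \<bullet> column j Q = (if i = j then 1 else 0)" for i j
    using Q(1) unfolding orthogonal_matrix_def matrix_mult_transpose_dot_column
    by (simp add: vec_eq_iff mat_def)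
  then have "F \<in> stiefel"
    using g by (simp add: stiefel_def matrix_mult_transpose_dot_column mat_def inj_eq col)
  moreover have "F *v (norm v *\<^sub>R axis j0 1) = v"
    using Q(2) u(2)
    by (simp add: col matrix_vector_mult_scaleR matrix_vector_mult_basis)
  ultimately show thesis
    using that by blast
qed

section \<open>Conic hulls\<close>

lemma zero_in_cone_of: "0 \<in> cone_of C"
  unfolding cone_of_def by (rule CollectI, rule exI[of _ 0]) auto

lemma cone_of_add:
  assumes "X \<in> cone_of C" "Y \<in> C"
  shows "X + Y \<in> cone_of C"
proof -
  obtain k \<alpha> x where X: "X = (\<Sum>i<(k::nat). \<alpha> i *\<^sub>R x i)" "\<forall>i<k. x i \<in> C \<and> \<alpha> i \<ge> 0"
    using assms(1) by (auto simp: cone_of_def)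
  \<comment> \<open>\<open>Y\<close> is appended as the term of index \<open>k\<close> with
    coefficient 1; the updates leave all smaller indices unchanged.\<close>
  have "X + Y = (\<Sum>i<Suc k. (\<alpha>(k := 1)) i *\<^sub>R (x(k := Y)) i)"
    by (simp add: X(1))
  moreover have "\<forall>i<Suc k. (x(k := Y)) i \<in> C \<and> (\<alpha>(k := 1)) i \<ge> 0"
    using X(2) assms(2) by (simp add: less_Suc_eq)
  ultimately show ?thesis
    unfolding cone_of_def by blast
qed

text \<open>A convex cone contains the empty sum 0 and absorbs one scaled term at a time.\<close>

lemma cone_of_minimal:
  assumes "convex_cone K" "C \<subseteq> K"
  shows "cone_of C \<subseteq> K"
proof -
  have "(\<Sum>i<(k::nat). \<alpha> i *\<^sub>R x i) \<in> K" if "\<forall>i<k. x i \<in> C \<and> \<alpha> i \<ge> 0" for k \<alpha> x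
    using that
  proof (induction k)
    case 0
    then show ?case
      using assms(1) by (simp add: convex_cone_contains_0)
  next
    case (Suc k)
    then show ?case
      using assms by (auto intro!: convex_cone_add convex_cone_scaleR)
  qed
  then show ?thesis
    by (auto simp: cone_of_def)
qed

theorem theorem3:
  assumes "CARD('s::finite) \<le> CARD('n::finite)"
  shows "(psd_mats :: (real^'n^'n) set) = cone_of (\<Union>F \<in> (stiefel :: (real^'s^'n) set). psd_block F)
    \<and> (\<forall>F \<in> (stiefel :: (real^'s^'n) set). psd_block F \<subseteq> psd_mats \<and> convex_cone (psd_block F))"
proof -
  let ?C = "\<Union>F \<in> (stiefel :: (real^'s^'n) set). psd_block F"
  have block_subset: "psd_block F \<subseteq> psd_mats" for F :: "real^'s^'n"
    by (auto simp: psd_block_def)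
  \<comment> \<open>A single block already contains \<open>outer v v\<close>: it suffices that
    \<open>v\<close> lies in the range of \<open>F\<close>.\<close>
  have outer_in: "outer v v \<in> ?C" for v
  proof -
    obtain F :: "real^'s^'n" and y where F: "F \<in> stiefel" "F *v y = v"
      using stiefel_range_contains[OF assms] by blast
    then have "outer v v = F ** outer y y ** transpose F"
      using outer_matrix_vector[of F y F y] by simp
    then show ?thesis
      using F(1) outer_self_psd by (auto simp: psd_block_eq_image)
  qed
  \<comment> \<open>The induction starts from the empty combination and adds one block element at
    each step.\<close>
  have "A \<in> cone_of ?C" if "A \<in> psd_mats" for A
    using that
  proof (induction rule: psd_induct)
    case zero
    show ?case
      by (rule zero_in_cone_of)
  next
    case (add_outer B v)
    then show ?case
      using outer_in by (intro cone_of_add)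
  qed
  moreover have "cone_of ?C \<subseteq> psd_mats"
    using block_subset by (intro cone_of_minimal convex_cone_psd_mats) blast
  ultimately show ?thesis
    using block_subset convex_cone_psd_block by blast
qed

end
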